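(* Suppose that $(a_1, b_1), (a_2, b_2), \dots, (a_{100}, b_{100})$ are distinct ordered pairs of nonnegative integers. Let $N$ denote the number of pairs of integers $(i, j)$ satisfying $1 \leq i < j \leq 100$ and $|a_ib_j - a_jb_i| = 1$. Determine the largest possible value of $N$ over all possible choices of the $100$ ordered pairs. *)

theory Defs imports Main
begin

definition admissible :: "(nat \<Rightarrow> nat) \<Rightarrow> (nat \<Rightarrow> nat) \<Rightarrow> bool" where
  "admissible a b \<longleftrightarrow> inj_on (\<lambda>i. (a i, b i)) {1..100}"

definition unit_pairs :: "(nat \<Rightarrow> nat) \<Rightarrow> (nat \<Rightarrow> nat) \<Rightarrow> (nat \<times> nat) set" where
  "unit_pairs a b = {(i, j). 1 \<le> i \<and> i < j \<and> j \<le> 100 \<and>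
     \<bar>int (a i) * int (b j) - int (a j) * int (b i)\<bar> = 1}"

end

theory Submission imports Defs
begin

text \<open>Join two vectors of \<open>\<nat>\<^sup>2\<close> when their determinant is \<open>1\<close> or \<open>-1\<close>. A vector \<open>p\<close> of largest coordinate
  sum has degree at most two: all solutions \<open>v\<close> of \<open>det p v = 1\<close> differ by multiples of \<open>p\<close>, so at
  most one nonzero solution has coordinate sum not exceeding that of \<open>p\<close>, and likewise for
  \<open>det p v = -1\<close>. Removing such vectors one at a time bounds the number of edges on \<open>n\<close> vectors by
  \<open>2n - 3\<close>. Equality holds for \<open>(0,1), (1,0), (1,1), \<dots>, (1,n-2)\<close>.\<close>

definition unit_det :: "(nat \<Rightarrow> nat) \<Rightarrow> (nat \<Rightarrow> nat) \<Rightarrow> nat \<Rightarrow> nat \<Rightarrow> bool" where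
  "unit_det a b i j \<longleftrightarrow> \<bar>int (a i) * int (b j) - int (a j) * int (b i)\<bar> = 1"

text \<open>The index set is a parameter so that an induction can delete vertices.\<close>

definition unit_edges :: "(nat \<Rightarrow> nat) \<Rightarrow> (nat \<Rightarrow> nat) \<Rightarrow> nat set \<Rightarrow> (nat \<times> nat) set" where
  "unit_edges a b I = {(i, j). i \<in> I \<and> j \<in> I \<and> i < j \<and> unit_det a b i j}"

lemma unit_det_sym: "unit_det a b i j \<longleftrightarrow> unit_det a b j i"
  unfolding unit_det_def by (subst abs_minus_commute) simp

lemma unit_pairs_eq_unit_edges: "unit_pairs a b = unit_edges a b {1..100}"
  unfolding unit_pairs_def unit_edges_def unit_det_def by auto

lemma finite_unit_edges: "finite I \<Longrightarrow> finite (unit_edges a b I)"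
  by (rule finite_subset[of _ "I \<times> I"]) (auto simp: unit_edges_def)

lemma det_solution_unique:
  fixes a b x y x' y' c :: int
  assumes nonneg: "a \<ge> 0" "b \<ge> 0" "x \<ge> 0" "y \<ge> 0" "x' \<ge> 0" "y' \<ge> 0"
    and unit: "\<bar>c\<bar> = 1"
    and v: "a * y - x * b = c" and v': "a * y' - x' * b = c"
    and le: "x + y \<le> a + b" "x' + y' \<le> a + b"
  shows "x = x' \<and> y = y'"
proof -
  \<comment> \<open>With \<open>p = (a, b)\<close>, \<open>v = (x, y)\<close>,
    \<open>v' = (x', y')\<close>, the aim is \<open>v - v' = k p\<close>. Taking determinants with
    \<open>v'\<close> forces \<open>det v v' = k c\<close>, and \<open>c * c = 1\<close> solves this
    for an integer \<open>k\<close> without division.\<close>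
  define k where "k = c * (x * y' - x' * y)"
  have cc: "c * c = 1" using unit by (auto simp: abs_if split: if_splits)
  have "k * a = c * (x * (a * y') - x' * (a * y))" by (simp add: k_def algebra_simps)
  also have "\<dots> = c * (x * (c + x' * b) - x' * (c + x * b))"
    using v v' by (simp add: algebra_simps)
  also have "\<dots> = (c * c) * (x - x')" by (simp add: algebra_simps)
  finally have ka: "k * a = x - x'" using cc by simp
  have "k * b = c * ((x * b) * y' - (x' * b) * y)" by (simp add: k_def algebra_simps)
  also have "\<dots> = c * ((a * y - c) * y' - (a * y' - c) * y)"
    using v v' by (simp add: algebra_simps)
  also have "\<dots> = (c * c) * (y - y')" by (simp add: algebra_simps)
  finally have kb: "k * b = y - y'" using cc by simp
  have sum: "k * (a + b) = (x + y) - (x' + y')" using ka kb by (simp add: algebra_simps)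
  \<comment> \<open>Both coordinate sums now lie in the half-open range from 0 (excluded) to
    \<open>a + b\<close>, so they differ by less than \<open>a + b\<close>. As their difference is
    \<open>k * (a + b)\<close>, only \<open>k = 0\<close> remains.\<close>
  have "\<not> (x = 0 \<and> y = 0)" "\<not> (x' = 0 \<and> y' = 0)" using v v' unit by auto
  then have pos: "x + y > 0" "x' + y' > 0" using nonneg by linarith+
  have "\<not> k \<ge> 1" using mult_right_mono[of 1 k "a + b"] nonneg le sum pos by auto
  moreover have "\<not> k \<le> -1" using mult_right_mono[of k "-1" "a + b"] nonneg le sum pos by auto
  ultimately have "k = 0" by linarith
  then show ?thesis using ka kb by simp
qed

lemma card_unit_det_le_2:
  assumes "finite I" and inj: "inj_on (\<lambda>i. (a i, b i)) I"
    and max: "\<And>j. j \<in> I \<Longrightarrow> a j + b j \<le> a m + b m"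
  shows "card {j \<in> I. unit_det a b m j} \<le> 2"
proof -
  \<comment> \<open>Neighbours of \<open>m\<close> are split by the sign of the determinant. Each
    class holds at most one vector, hence one index by injectivity.\<close>
  define N where "N c = {j \<in> I. int (a m) * int (b j) - int (a j) * int (b m) = c}" for c
  have N: "card (N c) \<le> Suc 0" if "\<bar>c\<bar> = 1" for c
  proof (subst card_le_Suc0_iff_eq)
    show "finite (N c)" using \<open>finite I\<close> by (simp add: N_def)
    show "\<forall>i\<in>N c. \<forall>j\<in>N c. i = j"
    proof (intro ballI)
      fix i j assume ij: "i \<in> N c" "j \<in> N c"
      have "int (a i) = int (a j) \<and> int (b i) = int (b j)"
        by (rule det_solution_unique[of "int (a m)" "int (b m)" _ _ _ _ c])
          (use ij that max[of i] max[of j] in \<open>auto simp: N_def\<close>)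
      then show "i = j" using ij inj by (auto simp: N_def inj_on_def)
    qed
  qed
  have "{j \<in> I. unit_det a b m j} = N 1 \<union> N (-1)"
    by (auto simp: N_def unit_det_def abs_if split: if_splits)
  then show ?thesis using card_Un_le[of "N 1" "N (-1)"] N[of 1] N[of "-1"] by simp
qed

text \<open>Induction on the number of vectors, deleting one of largest coordinate sum. Adding 3 on
  the left avoids truncated subtraction; the bound fails for a single vector, so the induction
  starts at two.\<close>

lemma card_unit_edges_le:
  assumes "finite I" "inj_on (\<lambda>i. (a i, b i)) I" "card I \<ge> 2"
  shows "card (unit_edges a b I) + 3 \<le> 2 * card I"
  using assms
proof (induction "card I" arbitrary: I rule: less_induct)
  case less
  show ?case
  proof (cases "card I = 2")
    case True
    then obtain x y where I: "I = {x, y}" "x \<noteq> y" by (meson card_2_iff)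
    have "unit_edges a b I \<subseteq> {(min x y, max x y)}" by (auto simp: unit_edges_def I)
    then have "card (unit_edges a b I) \<le> 1" by (rule card_mono[rotated, THEN order_trans]) simp_all
    then show ?thesis using True by simp
  next
    case False
    have "I \<noteq> {}" using less.prems by auto
    define M where "M = Max ((\<lambda>j. a j + b j) ` I)"
    have "M \<in> (\<lambda>j. a j + b j) ` I"
      unfolding M_def using \<open>finite I\<close> \<open>I \<noteq> {}\<close> by (intro Max_in) auto
    then obtain m where m: "m \<in> I" and M: "M = a m + b m" by blast
    have max: "a j + b j \<le> a m + b m" if "j \<in> I" for j
      unfolding M[symmetric] M_def using \<open>finite I\<close> that by (intro Max_ge) auto
    let ?J = "I - {m}" and ?N = "{j \<in> I. unit_det a b m j}"
    have card: "card I = Suc (card ?J)" using m \<open>finite I\<close> by (metis card_Suc_Diff1)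
    have IH: "card (unit_edges a b ?J) + 3 \<le> 2 * card ?J"
    proof (rule less.hyps)
      show "inj_on (\<lambda>i. (a i, b i)) ?J" using less.prems(2) by (rule inj_on_subset) auto
    qed (use less.prems card False in simp_all)
    \<comment> \<open>An edge either avoids \<open>m\<close> or is determined by its other endpoint;
      \<open>min\<close> and \<open>max\<close> put the two indices in increasing order.\<close>
    have "unit_edges a b I \<subseteq> unit_edges a b ?J \<union> (\<lambda>j. (min j m, max j m)) ` ?N"
    proof (rule subsetI)
      fix p
      assume "p \<in> unit_edges a b I"
      then obtain i j where p: "p = (i, j)" and ij: "i \<in> I" "j \<in> I" "i < j" "unit_det a b i j"
        by (auto simp: unit_edges_def)
      have "p = (min j m, max j m) \<and> j \<in> ?N" if "i = m" using that p ij by auto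
      moreover have "p = (min i m, max i m) \<and> i \<in> ?N" if "j = m"
        using that p ij unit_det_sym[of a b i m] by auto
      moreover have "p \<in> unit_edges a b ?J" if "i \<noteq> m" "j \<noteq> m"
        using that p ij by (simp add: unit_edges_def)
      ultimately show "p \<in> unit_edges a b ?J \<union> (\<lambda>j. (min j m, max j m)) ` ?N" by blast
    qed
    then have "card (unit_edges a b I) \<le> card (unit_edges a b ?J \<union> (\<lambda>j. (min j m, max j m)) ` ?N)"
      using \<open>finite I\<close> by (intro card_mono) (auto simp: finite_unit_edges)
    also have "\<dots> \<le> card (unit_edges a b ?J) + card ((\<lambda>j. (min j m, max j m)) ` ?N)"
      by (rule card_Un_le)
    also have "\<dots> \<le> card (unit_edges a b ?J) + card ?N"
      using \<open>finite I\<close> by (simp add: card_image_le)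
    also have "\<dots> \<le> card (unit_edges a b ?J) + 2"
      using card_unit_det_le_2[OF \<open>finite I\<close> less.prems(2) max] by simp
    finally show ?thesis using IH card by simp
  qed
qed

lemma exists_197_unit_pairs: "\<exists>a b. admissible a b \<and> card (unit_pairs a b) = 197"
proof (intro exI conjI)
  let ?a = "\<lambda>i::nat. if i = 1 then 0 else 1 :: nat"
  let ?b = "\<lambda>i::nat. if i = 1 then 1 else i - 2"
  show "admissible ?a ?b" by (auto simp: admissible_def inj_on_def)
  \<comment> \<open>The vector (0,1) is joined to all 99 others. Two vectors with first coordinate 1
    are joined when their second coordinates are consecutive, which gives a path with 98
    edges.\<close>
  have "unit_pairs ?a ?b = Pair 1 ` {2..100} \<union> (\<lambda>i. (i, Suc i)) ` {2..99}"
  proof (rule set_eqI)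
    fix p :: "nat \<times> nat"
    obtain i j where p: "p = (i, j)" by (cases p)
    consider "i = 0" | "i = 1" | "i \<ge> 2" by linarith
    then show "p \<in> unit_pairs ?a ?b \<longleftrightarrow> p \<in> Pair 1 ` {2..100} \<union> (\<lambda>i. (i, Suc i)) ` {2..99}"
    proof cases
      case 3
      have "\<bar>int (j - 2) - int (i - 2)\<bar> = 1 \<longleftrightarrow> j = Suc i" if "i < j"
        using 3 that by linarith
      then show ?thesis using 3 by (auto simp: p unit_pairs_def image_iff)
    qed (auto simp: p unit_pairs_def image_iff)
  qed
  moreover have "card (Pair (1::nat) ` {2..100::nat} \<union> (\<lambda>i. (i, Suc i)) ` {2..99}) = 99 + 98"
    by (subst card_Un_disjoint) (auto simp: card_image inj_on_def)
  ultimately show "card (unit_pairs ?a ?b) = 197" by simp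
qed

theorem mainTheorem4:
  "(\<exists>a b. admissible a b \<and> card (unit_pairs a b) = 197) \<and>
   (\<forall>a b. admissible a b \<longrightarrow> card (unit_pairs a b) \<le> 197)"
proof (intro conjI allI impI)
  fix a b
  assume "admissible a b"
  then have "card (unit_edges a b {1..100}) + 3 \<le> 2 * card {1..100::nat}"
    by (intro card_unit_edges_le) (simp_all add: admissible_def)
  then show "card (unit_pairs a b) \<le> 197" by (simp add: unit_pairs_eq_unit_edges)
qed (rule exists_197_unit_pairs)

end
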